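(* Let $V$ be a finite set and let $X=(X_j)_{j\in V}$ be a square-integrable random vector such that $\Sigma:=\operatorname{cov}(X)\succ0$. Then $$\mathcal{T}_j(S)=\mathfrak{T}_j(S;\operatorname{Proj}(X))$$ for all $j\in V$ and $S\subseteq V_{-j}$.
   Context: $V_{-j}=V\setminus\{j\}$. Each $X_j$ is viewed as an element of the Hilbert space $L^2$ of square-integrable random variables with inner product $\langle Y,Z\rangle=\mathbb{E}[YZ]$. For $S\subseteq V$, $P_S$ is the orthogonal projection in $L^2$ onto the span of $\{X_i: i\in S\}$, $P_j=P_{\{j\}}$, and $P_S^\perp=I-P_S$. Regression lattice: $\mathcal{T}_j(S)=\{U\subseteq V_{-j}:\ P_UP_j=P_SP_j\}$. Projection graphoid: for pairwise disjoint $A,B,C\subseteq V$, say $A\perp\!\!\!\perp B\mid C$ (partial orthogonality) iff $P_AP_C^\perp P_B=0$. With respect to this independence model, let $m(j;S)=\bigcap\{U\subseteq S:\ j\perp\!\!\!\perp S\setminus U\mid U\}$ and $$\mathfrak{T}_j(S;\operatorname{Proj}(X))=\{U\subseteq V_{-j}:\ m(j;U)=m(j;S)\}.$$ *)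

theory Defs
  imports "HOL-Probability.Probability"
begin

section \<open>Square-integrable random variables\<close>

text \<open>
  Elements of the real Hilbert space \<open>L\<^sup>2\<close> are handled through representatives: equality in
  \<open>L\<^sup>2\<close> is almost-everywhere equality of representatives, and accordingly two operators on
  \<open>L\<^sup>2\<close> are equal when they agree almost everywhere on every square-integrable function.
\<close>

definition L2 :: "'a measure \<Rightarrow> ('a \<Rightarrow> real) set" where
  "L2 M = {Y. Y \<in> borel_measurable M \<and> integrable M (\<lambda>\<omega>. (Y \<omega>)\<^sup>2)}"

definition L2_inner :: "'a measure \<Rightarrow> ('a \<Rightarrow> real) \<Rightarrow> ('a \<Rightarrow> real) \<Rightarrow> real" where
  "L2_inner M Y Z = (\<integral>\<omega>. Y \<omega> * Z \<omega> \<partial>M)"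

definition L2_op_eq ::
  "'a measure \<Rightarrow> (('a \<Rightarrow> real) \<Rightarrow> ('a \<Rightarrow> real)) \<Rightarrow> (('a \<Rightarrow> real) \<Rightarrow> ('a \<Rightarrow> real)) \<Rightarrow> bool" where
  "L2_op_eq M F G \<longleftrightarrow> (\<forall>Y\<in>L2 M. AE \<omega> in M. F Y \<omega> = G Y \<omega>)"

text \<open>
  The orthogonal projection of \<open>Y\<close> onto a subspace \<open>W\<close> is the element \<open>Z\<close> of \<open>W\<close> with
  \<open>Y - Z\<close> orthogonal to \<open>W\<close>. It is unique as an element of \<open>L\<^sup>2\<close>, that is, up to null sets,
  so \<open>SOME\<close> only picks a representative. The defining condition depends on \<open>Y\<close> only up to
  null sets, so the operator is well defined on classes.
\<close>

definition orth_proj ::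
  "'a measure \<Rightarrow> ('a \<Rightarrow> real) set \<Rightarrow> ('a \<Rightarrow> real) \<Rightarrow> ('a \<Rightarrow> real)" where
  "orth_proj M W Y =
     (SOME Z. Z \<in> W \<and> (\<forall>w\<in>W. L2_inner M (\<lambda>\<omega>. Y \<omega> - Z \<omega>) w = 0))"

section \<open>Covariance\<close>

definition cov :: "'a measure \<Rightarrow> ('v \<Rightarrow> 'a \<Rightarrow> real) \<Rightarrow> 'v \<Rightarrow> 'v \<Rightarrow> real" where
  "cov M X i k =
     (\<integral>\<omega>. (X i \<omega> - (\<integral>\<xi>. X i \<xi> \<partial>M)) * (X k \<omega> - (\<integral>\<xi>. X k \<xi> \<partial>M)) \<partial>M)"

definition pos_definite_on :: "'v set \<Rightarrow> ('v \<Rightarrow> 'v \<Rightarrow> real) \<Rightarrow> bool" where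
  "pos_definite_on V A \<longleftrightarrow>
     (\<forall>i\<in>V. \<forall>k\<in>V. A i k = A k i) \<and>
     (\<forall>c. (\<exists>i\<in>V. c i \<noteq> 0) \<longrightarrow> 0 < (\<Sum>i\<in>V. \<Sum>k\<in>V. c i * A i k * c k))"

section \<open>Projections onto spans of coordinates and the regression lattice\<close>

definition coord_span :: "('v \<Rightarrow> 'a \<Rightarrow> real) \<Rightarrow> 'v set \<Rightarrow> ('a \<Rightarrow> real) set" where
  "coord_span X S = range (\<lambda>c \<omega>. \<Sum>i\<in>S. c i * X i \<omega>)"

definition coord_proj ::
  "'a measure \<Rightarrow> ('v \<Rightarrow> 'a \<Rightarrow> real) \<Rightarrow> 'v set \<Rightarrow> ('a \<Rightarrow> real) \<Rightarrow> ('a \<Rightarrow> real)" where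
  "coord_proj M X S = orth_proj M (coord_span X S)"

definition coord_proj_perp ::
  "'a measure \<Rightarrow> ('v \<Rightarrow> 'a \<Rightarrow> real) \<Rightarrow> 'v set \<Rightarrow> ('a \<Rightarrow> real) \<Rightarrow> ('a \<Rightarrow> real)" where
  "coord_proj_perp M X S Y = (\<lambda>\<omega>. Y \<omega> - coord_proj M X S Y \<omega>)"

definition regression_lattice ::
  "'a measure \<Rightarrow> ('v \<Rightarrow> 'a \<Rightarrow> real) \<Rightarrow> 'v set \<Rightarrow> 'v \<Rightarrow> 'v set \<Rightarrow> 'v set set" where
  "regression_lattice M X V j S =
     {U. U \<subseteq> V - {j} \<and> L2_op_eq M (coord_proj M X U \<circ> coord_proj M X {j}) (coord_proj M X S \<circ> coord_proj M X {j})}"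

section \<open>Independence models and the projection graphoid\<close>

text \<open>An independence model \<open>I\<close> is a ternary relation; \<open>I A B C\<close> reads ``\<open>A\<close> is independent
  of \<open>B\<close> given \<open>C\<close>''.\<close>

type_synonym 'v indep_model = "'v set \<Rightarrow> 'v set \<Rightarrow> 'v set \<Rightarrow> bool"

text \<open>The family intersected in \<open>min_indep\<close> contains \<open>S\<close> itself as soon as \<open>I {j} {} S\<close>, which
  holds for \<open>Proj\<close> below when \<open>S \<subseteq> V - {j}\<close>; the intersection is then not vacuous.\<close>

definition min_indep :: "'v indep_model \<Rightarrow> 'v \<Rightarrow> 'v set \<Rightarrow> 'v set" where
  "min_indep I j S = \<Inter>{U. U \<subseteq> S \<and> I {j} (S - U) U}"

definition indep_lattice :: "'v set \<Rightarrow> 'v \<Rightarrow> 'v set \<Rightarrow> 'v indep_model \<Rightarrow> 'v set set" where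
  "indep_lattice V j S I = {U. U \<subseteq> V - {j} \<and> min_indep I j U = min_indep I j S}"

definition Proj :: "'a measure \<Rightarrow> ('v \<Rightarrow> 'a \<Rightarrow> real) \<Rightarrow> 'v set \<Rightarrow> 'v indep_model" where
  "Proj M X V A B C \<longleftrightarrow>
     A \<subseteq> V \<and> B \<subseteq> V \<and> C \<subseteq> V \<and> A \<inter> B = {} \<and> A \<inter> C = {} \<and> B \<inter> C = {} \<and>
     L2_op_eq M (coord_proj M X A \<circ> coord_proj_perp M X C \<circ> coord_proj M X B) (\<lambda>Y \<omega>. 0)"

end

theory Submission
  imports Defs
begin

text \<open>
  The projection of \<open>X j\<close> onto the span of \<open>X i\<close>, \<open>i \<in> S\<close>, has unique coefficients
  because the Gram matrix dominates the covariance matrix. Let \<open>N S\<close> be their support. For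
  \<open>U \<subseteq> S\<close>, self-adjointness of the projections turns independence of \<open>j\<close> and \<open>S - U\<close> given \<open>U\<close> into the statement that
  the projections of \<open>X j\<close> given \<open>U\<close> and given \<open>S\<close> agree, that is, \<open>N S \<subseteq> U\<close>; hence
  \<open>m(j;S) = N S\<close>. Conversely \<open>N S\<close> determines the projection: it is the projection
  onto the span over \<open>N S\<close>.
\<close>

section \<open>The inner product on representatives\<close>

lemma L2_borel_measurable: "f \<in> L2 M \<Longrightarrow> f \<in> borel_measurable M"
  by (simp add: L2_def)

text \<open>From 2|xy| \<le> x^2 + y^2, the product is dominated by the integrable function f^2 +
  g^2.\<close>

lemma L2_integrable_mult:
  assumes "f \<in> L2 M" "g \<in> L2 M"
  shows "integrable M (\<lambda>\<omega>. f \<omega> * g \<omega>)"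
proof (rule Bochner_Integration.integrable_bound)
  show "integrable M (\<lambda>\<omega>. (f \<omega>)\<^sup>2 + (g \<omega>)\<^sup>2)"
    using assms by (simp add: L2_def)
  show "(\<lambda>\<omega>. f \<omega> * g \<omega>) \<in> borel_measurable M"
    using assms by (intro borel_measurable_times L2_borel_measurable)
  have "norm (x * y) \<le> norm (x\<^sup>2 + y\<^sup>2)" for x y :: real
  proof -
    have "2 * (\<bar>x\<bar> * \<bar>y\<bar>) \<le> x\<^sup>2 + y\<^sup>2"
      using sum_squares_bound[of "\<bar>x\<bar>" "\<bar>y\<bar>"] by (simp add: mult.assoc)
    moreover have "0 \<le> \<bar>x\<bar> * \<bar>y\<bar>"
      by simp
    ultimately have "\<bar>x\<bar> * \<bar>y\<bar> \<le> x\<^sup>2 + y\<^sup>2"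
      by linarith
    then show ?thesis
      by (simp add: abs_mult)
  qed
  then show "AE \<omega> in M. norm (f \<omega> * g \<omega>) \<le> norm ((f \<omega>)\<^sup>2 + (g \<omega>)\<^sup>2)"
    by simp
qed

lemma L2_cmult: "f \<in> L2 M \<Longrightarrow> (\<lambda>\<omega>. a * f \<omega>) \<in> L2 M"
  unfolding L2_def by (auto simp: power_mult_distrib)

lemma L2_add:
  assumes "f \<in> L2 M" "g \<in> L2 M"
  shows "(\<lambda>\<omega>. f \<omega> + g \<omega>) \<in> L2 M"
proof -
  have "integrable M (\<lambda>\<omega>. (f \<omega>)\<^sup>2 + (g \<omega>)\<^sup>2 + 2 * (f \<omega> * g \<omega>))"
    using assms L2_integrable_mult[OF assms] by (simp add: L2_def)
  then show ?thesis
    using assms unfolding L2_def by (auto simp: power2_sum mult.assoc)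
qed

lemma L2_diff:
  assumes "f \<in> L2 M" "g \<in> L2 M"
  shows "(\<lambda>\<omega>. f \<omega> - g \<omega>) \<in> L2 M"
  using L2_add[OF assms(1) L2_cmult[OF assms(2), of "-1"]] by simp

lemma L2_sum: "(\<And>i. i \<in> S \<Longrightarrow> f i \<in> L2 M) \<Longrightarrow> (\<lambda>\<omega>. \<Sum>i\<in>S. f i \<omega>) \<in> L2 M"
proof (induction S rule: infinite_finite_induct)
  case (insert i S)
  then show ?case
    using L2_add[of "f i" M "\<lambda>\<omega>. \<Sum>i\<in>S. f i \<omega>"] by simp
qed (simp_all add: L2_def)

lemma L2_const: "prob_space M \<Longrightarrow> (\<lambda>_. a) \<in> L2 M"
  by (simp add: L2_def prob_space.finite_measure finite_measure.integrable_const)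

lemma L2_integrable:
  assumes "prob_space M" "f \<in> L2 M"
  shows "integrable M f"
  using L2_integrable_mult[OF assms(2) L2_const[OF assms(1), of 1]] by simp

lemma L2_inner_commute: "L2_inner M f g = L2_inner M g f"
  by (simp add: L2_inner_def mult.commute)

lemma L2_inner_cmult_left: "L2_inner M (\<lambda>\<omega>. a * f \<omega>) g = a * L2_inner M f g"
  by (simp add: L2_inner_def mult.assoc)

lemma L2_inner_diff_left:
  "f \<in> L2 M \<Longrightarrow> g \<in> L2 M \<Longrightarrow> h \<in> L2 M \<Longrightarrow>
    L2_inner M (\<lambda>\<omega>. f \<omega> - g \<omega>) h = L2_inner M f h - L2_inner M g h"
  by (simp add: L2_inner_def left_diff_distrib L2_integrable_mult)

lemma L2_inner_diff_right:
  "f \<in> L2 M \<Longrightarrow> g \<in> L2 M \<Longrightarrow> h \<in> L2 M \<Longrightarrow>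
    L2_inner M h (\<lambda>\<omega>. f \<omega> - g \<omega>) = L2_inner M h f - L2_inner M h g"
  by (simp add: L2_inner_def right_diff_distrib L2_integrable_mult)

lemma L2_inner_sum_right:
  assumes "f \<in> L2 M" "\<And>i. i \<in> S \<Longrightarrow> g i \<in> L2 M"
  shows "L2_inner M f (\<lambda>\<omega>. \<Sum>i\<in>S. c i * g i \<omega>) = (\<Sum>i\<in>S. c i * L2_inner M f (g i))"
proof -
  have "integrable M (\<lambda>\<omega>. c i * (f \<omega> * g i \<omega>))" if "i \<in> S" for i
    using L2_integrable_mult[OF assms(1) assms(2)[OF that]] by simp
  then have "(\<integral>\<omega>. (\<Sum>i\<in>S. c i * (f \<omega> * g i \<omega>)) \<partial>M) = (\<Sum>i\<in>S. c i * L2_inner M f (g i))"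
    by (simp add: L2_inner_def)
  then show ?thesis
    by (simp add: L2_inner_def sum_distrib_left mult.left_commute)
qed

lemma L2_inner_self_eq_0:
  assumes "f \<in> L2 M" "L2_inner M f f = 0"
  shows "AE \<omega> in M. f \<omega> = 0"
proof -
  have "AE \<omega> in M. f \<omega> * f \<omega> = 0"
    using integral_nonneg_eq_0_iff_AE[OF L2_integrable_mult[OF assms(1) assms(1)]] assms(2)
    by (simp add: L2_inner_def)
  then show ?thesis
    by simp
qed

section \<open>Regression coefficients\<close>

locale nondegenerate_family =
  fixes M :: "'a measure" and V :: "'v set" and X :: "'v \<Rightarrow> 'a \<Rightarrow> real"
  assumes prob: "prob_space M"
    and finite_V: "finite V"
    and X_L2: "\<And>i. i \<in> V \<Longrightarrow> X i \<in> L2 M"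
    and pos: "pos_definite_on V (cov M X)"
begin

section \<open>Linear combinations of the variables and their linear independence\<close>

text \<open>The sum always runs over all of \<open>V\<close>; a subset enters only through
  coefficients that vanish off it. Combinations over different subsets can then be compared as
  coefficient functions.\<close>

definition comb :: "('v \<Rightarrow> real) \<Rightarrow> 'a \<Rightarrow> real" where
  "comb c = (\<lambda>\<omega>. \<Sum>i\<in>V. c i * X i \<omega>)"

lemma comb_L2: "comb c \<in> L2 M"
  unfolding comb_def by (intro L2_sum L2_cmult X_L2)

lemma comb_diff: "comb (\<lambda>i. c i - d i) = (\<lambda>\<omega>. comb c \<omega> - comb d \<omega>)"
  by (simp add: comb_def left_diff_distrib sum_subtractf)

lemma comb_add: "comb (\<lambda>i. c i + d i) = (\<lambda>\<omega>. comb c \<omega> + comb d \<omega>)"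
  by (simp add: comb_def distrib_right sum.distrib)

lemma comb_cmult: "comb (\<lambda>i. a * c i) = (\<lambda>\<omega>. a * comb c \<omega>)"
  by (simp add: comb_def sum_distrib_left mult.assoc)

lemma comb_supported:
  assumes "S \<subseteq> V" "\<And>i. i \<notin> S \<Longrightarrow> c i = 0"
  shows "comb c = (\<lambda>\<omega>. \<Sum>i\<in>S. c i * X i \<omega>)"
  unfolding comb_def using assms finite_V by (intro ext sum.mono_neutral_right) auto

lemma comb_single:
  assumes "j \<in> V" "\<And>i. i \<noteq> j \<Longrightarrow> c i = 0"
  shows "comb c = (\<lambda>\<omega>. c j * X j \<omega>)"
  using comb_supported[of "{j}" c] assms by simp

lemma comb_unit: "j \<in> V \<Longrightarrow> comb (\<lambda>i. if i = j then 1 else 0) = X j"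
  using comb_single[of j "\<lambda>i. if i = j then 1 else 0"] by simp

lemma L2_inner_comb_right:
  assumes "f \<in> L2 M"
  shows "L2_inner M f (comb c) = (\<Sum>i\<in>V. c i * L2_inner M f (X i))"
  unfolding comb_def by (intro L2_inner_sum_right assms X_L2)

lemma L2_inner_comb_right_eq_0:
  assumes "f \<in> L2 M" "\<And>i. i \<notin> S \<Longrightarrow> c i = 0" "\<And>k. k \<in> S \<Longrightarrow> L2_inner M f (X k) = 0"
  shows "L2_inner M f (comb c) = 0"
  unfolding L2_inner_comb_right[OF assms(1)]
  using assms(2,3) by (intro sum.neutral) (metis mult_eq_0_iff)

text \<open>Linear independence in L2. A combination that vanishes almost everywhere has mean zero,
  so it equals its centred version \<open>Y\<close>, whose second moment is the quadratic form of
  the covariance matrix at \<open>c\<close>. Positive definiteness forbids the value 0 when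
  \<open>c i\<close> is nonzero.\<close>

lemma comb_AE_0D:
  assumes ae: "AE \<omega> in M. comb c \<omega> = 0" and i: "i \<in> V"
  shows "c i = 0"
proof (rule ccontr)
  assume "c i \<noteq> 0"
  define Z where "Z i \<omega> = X i \<omega> - (\<integral>\<xi>. X i \<xi> \<partial>M)" for i \<omega>
  have Z_L2: "Z k \<in> L2 M" if "k \<in> V" for k
    unfolding Z_def using that by (intro L2_diff X_L2 L2_const prob)
  define Y where "Y \<omega> = (\<Sum>k\<in>V. c k * Z k \<omega>)" for \<omega>
  have Y_L2: "Y \<in> L2 M"
    unfolding Y_def by (intro L2_sum L2_cmult Z_L2)
  have "(\<integral>\<omega>. comb c \<omega> \<partial>M) = (\<Sum>k\<in>V. c k * (\<integral>\<omega>. X k \<omega> \<partial>M))"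
    using X_L2 L2_integrable[OF prob] by (simp add: comb_def)
  moreover have "(\<integral>\<omega>. comb c \<omega> \<partial>M) = 0"
    using ae by (rule integral_eq_zero_AE)
  \<comment> \<open>\<open>Y\<close> and \<open>comb c\<close> differ only by the constant mean of
    \<open>comb c\<close>, which is 0.\<close>
  ultimately have "Y \<omega> = comb c \<omega>" for \<omega>
    by (simp add: Y_def Z_def comb_def right_diff_distrib sum_subtractf)
  then have "AE \<omega> in M. Y \<omega> * Y \<omega> = 0"
    using ae by simp
  then have "L2_inner M Y Y = 0"
    unfolding L2_inner_def by (rule integral_eq_zero_AE)
  moreover have "L2_inner M Y Y = (\<Sum>i\<in>V. \<Sum>k\<in>V. c i * cov M X i k * c k)"
  proof -
    have inner_Z: "L2_inner M f Y = (\<Sum>k\<in>V. c k * L2_inner M f (Z k))" if "f \<in> L2 M" for f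
      unfolding Y_def using that by (intro L2_inner_sum_right Z_L2)
    have "L2_inner M Y Y = (\<Sum>i\<in>V. c i * L2_inner M (Z i) Y)"
      unfolding inner_Z[OF Y_L2] by (intro sum.cong refl arg_cong2[of _ _ _ _ "(*)"] L2_inner_commute)
    also have "\<dots> = (\<Sum>i\<in>V. \<Sum>k\<in>V. c i * cov M X i k * c k)"
    proof (intro sum.cong refl)
      fix i assume "i \<in> V"
      have "L2_inner M (Z i) (Z k) = cov M X i k" for k
        by (simp add: L2_inner_def Z_def cov_def)
      then show "c i * L2_inner M (Z i) Y = (\<Sum>k\<in>V. c i * cov M X i k * c k)"
        by (simp add: inner_Z[OF Z_L2[OF \<open>i \<in> V\<close>]] sum_distrib_left ac_simps)
    qed
    finally show ?thesis .
  qed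
  moreover have "0 < (\<Sum>i\<in>V. \<Sum>k\<in>V. c i * cov M X i k * c k)"
    using pos i \<open>c i \<noteq> 0\<close> by (auto simp: pos_definite_on_def)
  ultimately show False
    by simp
qed

lemma comb_inner_self_eq_0D:
  assumes "L2_inner M (comb c) (comb c) = 0" "i \<in> V"
  shows "c i = 0"
  using L2_inner_self_eq_0[OF comb_L2 assms(1)] assms(2) by (rule comb_AE_0D)

section \<open>Normal equations: uniqueness and existence of solutions\<close>

text \<open>The least-squares equations, tested on the generators \<open>X k\<close> only. The
  support condition fixes \<open>c\<close> on the whole index type, so a solution is unique as a
  function.\<close>

definition normal_eqs :: "'v set \<Rightarrow> ('a \<Rightarrow> real) \<Rightarrow> ('v \<Rightarrow> real) \<Rightarrow> bool" where
  "normal_eqs S Y c \<longleftrightarrow>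
    (\<forall>i. i \<notin> S \<longrightarrow> c i = 0) \<and> (\<forall>k\<in>S. L2_inner M (\<lambda>\<omega>. Y \<omega> - comb c \<omega>) (X k) = 0)"

lemma normal_eqs_orthogonal:
  assumes "normal_eqs S Y c" "Y \<in> L2 M" "\<And>i. i \<notin> S \<Longrightarrow> d i = 0"
  shows "L2_inner M (\<lambda>\<omega>. Y \<omega> - comb c \<omega>) (comb d) = 0"
  using assms by (intro L2_inner_comb_right_eq_0[of _ S] L2_diff comb_L2) (auto simp: normal_eqs_def)

lemma normal_eqs_cmult:
  assumes "normal_eqs S Y c"
  shows "normal_eqs S (\<lambda>\<omega>. a * Y \<omega>) (\<lambda>i. a * c i)"
  using assms
  by (simp add: normal_eqs_def comb_cmult right_diff_distrib[symmetric] L2_inner_cmult_left)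

lemma normal_eqs_antimono:
  assumes "normal_eqs S Y c" "U \<subseteq> S" "\<And>i. i \<notin> U \<Longrightarrow> c i = 0"
  shows "normal_eqs U Y c"
  using assms by (auto simp: normal_eqs_def)

text \<open>The combination with the difference of two solutions as coefficients is a difference of
  two residuals. Both residuals are orthogonal to it, so its norm is 0 and linear independence
  applies.\<close>

lemma normal_eqs_unique:
  assumes "normal_eqs S Y c" "normal_eqs S Y d" "S \<subseteq> V" "Y \<in> L2 M"
  shows "c = d"
proof
  fix i
  let ?e = "\<lambda>i. c i - d i"
  have e0: "?e i = 0" if "i \<notin> S" for i
    using assms(1,2) that by (simp add: normal_eqs_def)
  have "L2_inner M (comb ?e) (comb ?e) =
      L2_inner M (\<lambda>\<omega>. (Y \<omega> - comb d \<omega>) - (Y \<omega> - comb c \<omega>)) (comb ?e)"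
    by (simp add: comb_diff)
  also have "\<dots> = 0"
    using normal_eqs_orthogonal[OF assms(1,4), of ?e] normal_eqs_orthogonal[OF assms(2,4), of ?e]
    by (simp add: L2_inner_diff_left L2_diff assms(4) comb_L2 e0)
  finally show "c i = d i"
    using comb_inner_self_eq_0D[of ?e i] e0[of i] assms(3) by auto
qed

text \<open>Gram--Schmidt: the residual \<open>r\<close> of the new variable is orthogonal to the old ones.\<close>
lemma normal_eqs_exists:
  assumes "S \<subseteq> V" "Y \<in> L2 M"
  shows "\<exists>c. normal_eqs S Y c"
proof -
  have "finite S"
    using assms(1) finite_V by (rule finite_subset)
  then show ?thesis
    using assms
  proof (induction S arbitrary: Y)
    case empty
    show ?case
      by (auto simp: normal_eqs_def)
  next
    case (insert a S Y)
    then have a: "a \<in> V" "S \<subseteq> V" "a \<notin> S"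
      by auto
    obtain c where c: "normal_eqs S Y c"
      using insert by blast
    obtain d where d: "normal_eqs S (X a) d"
      using insert.IH[of "X a"] a X_L2 by blast
    define e where "e i = (if i = a then 1 else 0) - d i" for i
    define r where "r = comb e"
    have r: "r = (\<lambda>\<omega>. X a \<omega> - comb d \<omega>)"
      unfolding r_def e_def comb_diff by (simp add: comb_unit a)
    have r_L2: "r \<in> L2 M"
      unfolding r_def by (rule comb_L2)
    \<comment> \<open>The coefficient of the projection of \<open>Y\<close> onto the line spanned by
      \<open>r\<close>.\<close>
    define t where "t = L2_inner M Y r / L2_inner M r r"
    \<comment> \<open>Since \<open>d\<close> vanishes off \<open>S\<close>, \<open>e a\<close> is 1;
      linear independence then makes the denominator of \<open>t\<close> nonzero.\<close>
    have "e a \<noteq> 0"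
      using d a by (simp add: e_def normal_eqs_def)
    then have rr: "L2_inner M r r \<noteq> 0"
      using comb_inner_self_eq_0D a(1) unfolding r_def by blast
    define c' where "c' i = c i + t * e i" for i
    have comb_c': "comb c' = (\<lambda>\<omega>. comb c \<omega> + t * r \<omega>)"
      unfolding c'_def comb_add comb_cmult r_def ..
    have inner: "L2_inner M (\<lambda>\<omega>. Y \<omega> - comb c' \<omega>) f =
        L2_inner M (\<lambda>\<omega>. Y \<omega> - comb c \<omega>) f - t * L2_inner M r f" if "f \<in> L2 M" for f
    proof -
      have "(\<lambda>\<omega>. Y \<omega> - comb c' \<omega>) = (\<lambda>\<omega>. (Y \<omega> - comb c \<omega>) - t * r \<omega>)"
        by (simp add: comb_c' algebra_simps)
      then show ?thesis
        using that insert.prems(2) r_L2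
        by (simp add: L2_inner_diff_left L2_inner_cmult_left L2_diff L2_cmult comb_L2)
    qed
    have old: "L2_inner M (\<lambda>\<omega>. Y \<omega> - comb c' \<omega>) (X k) = 0" if "k \<in> S" for k
    proof -
      have "L2_inner M r (X k) = 0" "L2_inner M (\<lambda>\<omega>. Y \<omega> - comb c \<omega>) (X k) = 0"
        using c d that by (auto simp: r normal_eqs_def)
      then show ?thesis
        using inner X_L2 a that by auto
    qed
    have d0: "d i = 0" "c i = 0" if "i \<notin> S" for i
      using c d that by (auto simp: normal_eqs_def)
    \<comment> \<open>Hence \<open>Y\<close> and \<open>Y - comb c\<close> have the same inner
      product with \<open>r\<close>, which is why \<open>t\<close> may be computed from
      \<open>Y\<close>.\<close>
    have "L2_inner M (comb c) r = 0"
      using normal_eqs_orthogonal[OF d X_L2[OF a(1)] d0(2)] by (simp add: r L2_inner_commute)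
    then have "L2_inner M (\<lambda>\<omega>. Y \<omega> - comb c' \<omega>) r = 0"
      using rr insert.prems(2) r_L2
      by (simp add: inner[OF r_L2] L2_inner_diff_left comb_L2 t_def)
    moreover have "L2_inner M (\<lambda>\<omega>. Y \<omega> - comb c' \<omega>) (comb d) = 0"
      using insert.prems(2) old d0(1)
      by (intro L2_inner_comb_right_eq_0[of _ S] L2_diff comb_L2) auto
    \<comment> \<open>\<open>X a\<close> is the sum of \<open>r\<close> and \<open>comb d\<close>,
      and the new residual is orthogonal to both.\<close>
    ultimately have "L2_inner M (\<lambda>\<omega>. Y \<omega> - comb c' \<omega>) (X a) = 0"
      using insert.prems(2) X_L2[OF a(1)]
      by (simp add: r L2_inner_diff_right L2_diff comb_L2)
    then have "normal_eqs (insert a S) Y c'"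
      using old d0 by (simp add: normal_eqs_def c'_def e_def)
    then show ?case
      by blast
  qed
qed

definition coef :: "'v set \<Rightarrow> ('a \<Rightarrow> real) \<Rightarrow> 'v \<Rightarrow> real" where
  "coef S Y = (THE c. normal_eqs S Y c)"

lemma coef_eqI:
  assumes "normal_eqs S Y c" "S \<subseteq> V" "Y \<in> L2 M"
  shows "coef S Y = c"
  unfolding coef_def using assms normal_eqs_unique by blast

lemma normal_eqs_coef:
  assumes "S \<subseteq> V" "Y \<in> L2 M"
  shows "normal_eqs S Y (coef S Y)"
  using normal_eqs_exists[OF assms] coef_eqI[OF _ assms] by auto

lemma coef_outside: "S \<subseteq> V \<Longrightarrow> Y \<in> L2 M \<Longrightarrow> i \<notin> S \<Longrightarrow> coef S Y i = 0"
  using normal_eqs_coef by (simp add: normal_eqs_def)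

section \<open>Projections onto coordinate spans\<close>

lemma coord_span_eq:
  assumes "S \<subseteq> V"
  shows "coord_span X S = comb ` {c. \<forall>i. i \<notin> S \<longrightarrow> c i = 0}"
proof (intro equalityI subsetI)
  fix f assume "f \<in> coord_span X S"
  then obtain c where f: "f = (\<lambda>\<omega>. \<Sum>i\<in>S. c i * X i \<omega>)"
    by (auto simp: coord_span_def)
  have "f = comb (\<lambda>i. if i \<in> S then c i else 0)"
    using comb_supported[OF assms, of "\<lambda>i. if i \<in> S then c i else 0"] by (simp add: f)
  then show "f \<in> comb ` {c. \<forall>i. i \<notin> S \<longrightarrow> c i = 0}"
    by auto
next
  fix f assume "f \<in> comb ` {c. \<forall>i. i \<notin> S \<longrightarrow> c i = 0}"
  then show "f \<in> coord_span X S"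
    using comb_supported[OF assms] by (auto simp: coord_span_def)
qed

text \<open>An equality of functions, not just almost everywhere: distinct elements of the span are
  distinct in \<open>L\<^sup>2\<close>, so \<open>SOME\<close> in \<open>orth_proj\<close> has no choice.\<close>
lemma coord_proj_eq_comb:
  assumes "S \<subseteq> V" "Y \<in> L2 M"
  shows "coord_proj M X S Y = comb (coef S Y)"
  unfolding coord_proj_def orth_proj_def
proof (rule some_equality)
  show "comb (coef S Y) \<in> coord_span X S \<and>
      (\<forall>w\<in>coord_span X S. L2_inner M (\<lambda>\<omega>. Y \<omega> - comb (coef S Y) \<omega>) w = 0)"
    using normal_eqs_coef[OF assms] normal_eqs_orthogonal[OF normal_eqs_coef[OF assms] assms(2)]
    by (auto simp: coord_span_eq[OF assms(1)] normal_eqs_def)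
next
  fix Z
  assume Z: "Z \<in> coord_span X S \<and>
      (\<forall>w\<in>coord_span X S. L2_inner M (\<lambda>\<omega>. Y \<omega> - Z \<omega>) w = 0)"
  then obtain c where c: "Z = comb c" "\<forall>i. i \<notin> S \<longrightarrow> c i = 0"
    by (auto simp: coord_span_eq[OF assms(1)])
  \<comment> \<open>With the generators in the span, orthogonality to the span gives back the normal
    equations, whose solution is unique.\<close>
  have "X k \<in> coord_span X S" if "k \<in> S" for k
  proof -
    have "X k = comb (\<lambda>i. if i = k then 1 else 0)"
      using comb_unit assms(1) that by auto
    then show ?thesis
      unfolding coord_span_eq[OF assms(1)] using that by (intro image_eqI) auto
  qed
  then have "normal_eqs S Y c"
    using Z c by (simp add: normal_eqs_def)
  then show "Z = comb (coef S Y)"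
    using coef_eqI[OF _ assms] c(1) by simp
qed

lemma coord_proj_L2:
  "S \<subseteq> V \<Longrightarrow> Y \<in> L2 M \<Longrightarrow> coord_proj M X S Y \<in> L2 M"
  by (simp add: coord_proj_eq_comb comb_L2)

text \<open>Linear independence turns equality up to null sets into equality of coefficients on
  \<open>V\<close>; off \<open>V\<close> both coefficient functions are 0.\<close>

lemma coord_proj_AE_eq_iff:
  assumes "S \<subseteq> V" "U \<subseteq> V" "Y \<in> L2 M"
  shows "(AE \<omega> in M. coord_proj M X U Y \<omega> = coord_proj M X S Y \<omega>) \<longleftrightarrow> coef U Y = coef S Y"
proof
  let ?e = "\<lambda>i. coef U Y i - coef S Y i"
  assume "AE \<omega> in M. coord_proj M X U Y \<omega> = coord_proj M X S Y \<omega>"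
  then have "AE \<omega> in M. comb ?e \<omega> = 0"
    by (simp add: coord_proj_eq_comb assms comb_diff)
  then have "?e i = 0" for i
    using comb_AE_0D[of ?e i] coef_outside[OF assms(2,3), of i] coef_outside[OF assms(1,3), of i]
      assms(1,2) by (metis diff_self subsetD)
  then show "coef U Y = coef S Y"
    by auto
qed (simp add: coord_proj_eq_comb assms)

text \<open>The unit vector at \<open>k\<close> solves the normal equations with residual 0.\<close>

lemma coord_proj_fixes:
  assumes "S \<subseteq> V" "k \<in> S"
  shows "coord_proj M X S (X k) = X k"
proof -
  have k: "k \<in> V"
    using assms by auto
  have "normal_eqs S (X k) (\<lambda>i. if i = k then 1 else 0)"
    using assms(2) by (simp add: normal_eqs_def comb_unit[OF k] L2_inner_def)
  then show ?thesis
    using coord_proj_eq_comb coef_eqI assms(1) X_L2[OF k] comb_unit[OF k] by simp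
qed

text \<open>Homogeneity is the part of linearity used to compose with the projection for
  \<open>{j}\<close>, whose values are multiples of \<open>X j\<close>.\<close>

lemma coord_proj_cmult:
  assumes "S \<subseteq> V" "Y \<in> L2 M"
  shows "coord_proj M X S (\<lambda>\<omega>. a * Y \<omega>) = (\<lambda>\<omega>. a * coord_proj M X S Y \<omega>)"
  using coef_eqI[OF normal_eqs_cmult[OF normal_eqs_coef[OF assms]] assms(1) L2_cmult[OF assms(2)]]
  by (simp add: coord_proj_eq_comb assms L2_cmult comb_cmult)

lemma coord_proj_single:
  assumes "j \<in> V" "Y \<in> L2 M"
  shows "coord_proj M X {j} Y = (\<lambda>\<omega>. coef {j} Y j * X j \<omega>)"
  using assms coef_outside[of "{j}" Y] comb_single[of j "coef {j} Y"]
  by (simp add: coord_proj_eq_comb)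

text \<open>Both sides say that the zero coefficients solve the normal equations for
  \<open>{j}\<close>.\<close>

lemma coord_proj_single_AE_0_iff:
  assumes "j \<in> V" "Y \<in> L2 M"
  shows "(AE \<omega> in M. coord_proj M X {j} Y \<omega> = 0) \<longleftrightarrow> L2_inner M Y (X j) = 0"
proof -
  have "(AE \<omega> in M. coord_proj M X {j} Y \<omega> = 0) \<longleftrightarrow> normal_eqs {j} Y (\<lambda>_. 0)"
  proof
    assume "AE \<omega> in M. coord_proj M X {j} Y \<omega> = 0"
    then have "coef {j} Y i = 0" for i
      using comb_AE_0D[of "coef {j} Y" i] coef_outside[of "{j}" Y i] assms
      by (cases "i = j") (auto simp: coord_proj_eq_comb)
    then have "coef {j} Y = (\<lambda>_. 0)"
      by auto
    then show "normal_eqs {j} Y (\<lambda>_. 0)"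
      using normal_eqs_coef[of "{j}" Y] assms by simp
  next
    assume "normal_eqs {j} Y (\<lambda>_. 0)"
    then have "coef {j} Y = (\<lambda>_. 0)"
      using coef_eqI assms by simp
    then show "AE \<omega> in M. coord_proj M X {j} Y \<omega> = 0"
      using assms by (simp add: coord_proj_eq_comb comb_def)
  qed
  then show ?thesis
    by (simp add: normal_eqs_def comb_def)
qed

text \<open>Writing P for the projection, <PY,Z> = <PY,PZ> = <Y,PZ>, because the residuals of
  \<open>Y\<close> and \<open>Z\<close> are orthogonal to the span. Subtracting from <Y,Z> gives the
  claim for I - P.\<close>

lemma coord_proj_perp_self_adjoint:
  assumes "S \<subseteq> V" "Y \<in> L2 M" "Z \<in> L2 M"
  shows "L2_inner M (coord_proj_perp M X S Y) Z = L2_inner M Y (coord_proj_perp M X S Z)"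
proof -
  have perp: "L2_inner M f (comb (coef S g)) = L2_inner M (comb (coef S f)) (comb (coef S g))"
    if "f \<in> L2 M" "g \<in> L2 M" for f g
    using normal_eqs_orthogonal[OF normal_eqs_coef[OF assms(1) that(1)] that(1), of "coef S g"]
    by (simp add: coef_outside[OF assms(1) that(2)] L2_inner_diff_left comb_L2 that)
  have "L2_inner M (comb (coef S Y)) Z = L2_inner M (comb (coef S Z)) (comb (coef S Y))"
    using perp[OF assms(3,2)] by (simp add: L2_inner_commute)
  also have "\<dots> = L2_inner M Y (comb (coef S Z))"
    using perp[OF assms(2,3)] by (simp add: L2_inner_commute)
  finally show ?thesis
    by (simp add: coord_proj_perp_def coord_proj_eq_comb assms
        L2_inner_diff_left L2_inner_diff_right comb_L2)
qed

section \<open>The two lattices\<close>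

text \<open>The projection for \<open>{j}\<close> sends every Y to a multiple of \<open>X j\<close>
  and fixes \<open>X j\<close>, so the two composed operators agree as soon as they agree at
  \<open>X j\<close>.\<close>

lemma regression_lattice_eq:
  assumes "j \<in> V" "S \<subseteq> V"
  shows "regression_lattice M X V j S = {U. U \<subseteq> V - {j} \<and> coef U (X j) = coef S (X j)}"
proof -
  have "L2_op_eq M (coord_proj M X U \<circ> coord_proj M X {j}) (coord_proj M X S \<circ> coord_proj M X {j})
      \<longleftrightarrow> coef U (X j) = coef S (X j)" (is "?L \<longleftrightarrow> ?R") if U: "U \<subseteq> V" for U
  proof
    assume ?L
    then have "AE \<omega> in M. coord_proj M X U (X j) \<omega> = coord_proj M X S (X j) \<omega>"
      using assms(1) X_L2 coord_proj_fixes[of "{j}" j] by (force simp: L2_op_eq_def)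
    then show ?R
      using coord_proj_AE_eq_iff[OF assms(2) U] X_L2 assms(1) by simp
  next
    assume ?R
    then have "coord_proj M X U (X j) = coord_proj M X S (X j)"
      using coord_proj_eq_comb[OF U X_L2] coord_proj_eq_comb[OF assms(2) X_L2] assms(1) by simp
    then show ?L
      using assms U
      by (simp add: L2_op_eq_def coord_proj_single coord_proj_cmult X_L2)
  qed
  then show ?thesis
    unfolding regression_lattice_def by blast
qed

section \<open>Supports of the coefficients and minimal conditioning sets\<close>

definition coef_support :: "'v \<Rightarrow> 'v set \<Rightarrow> 'v set" where
  "coef_support j S = {i. coef S (X j) i \<noteq> 0}"

lemma coef_support_subset:
  "j \<in> V \<Longrightarrow> S \<subseteq> V \<Longrightarrow> coef_support j S \<subseteq> S"
  unfolding coef_support_def using coef_outside X_L2 by blast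

text \<open>The coefficients for \<open>S\<close> vanish off \<open>U\<close>, so they also solve
  the smaller system for \<open>U\<close>; uniqueness identifies them.\<close>

lemma coef_subset_eqI:
  assumes "j \<in> V" "S \<subseteq> V" "U \<subseteq> S" "coef_support j S \<subseteq> U"
  shows "coef U (X j) = coef S (X j)"
proof (rule coef_eqI)
  show "normal_eqs U (X j) (coef S (X j))"
    using assms(4)
    by (intro normal_eqs_antimono[OF normal_eqs_coef assms(3)] assms(1,2) X_L2)
      (auto simp: coef_support_def)
qed (use assms X_L2 in auto)

text \<open>For the direction from supports to coefficients, restrict the regressions on
  \<open>U\<close> and on \<open>S\<close> to the common support: each keeps its coefficients, so
  they agree.\<close>

lemma coef_eq_iff_coef_support_eq:
  assumes "j \<in> V" "S \<subseteq> V" "U \<subseteq> V"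
  shows "coef U (X j) = coef S (X j) \<longleftrightarrow> coef_support j U = coef_support j S"
proof
  assume "coef_support j U = coef_support j S"
  then show "coef U (X j) = coef S (X j)"
    using coef_subset_eqI[OF assms(1,3), of "coef_support j U"]
      coef_subset_eqI[OF assms(1,2), of "coef_support j S"]
      coef_support_subset[OF assms(1,2)] coef_support_subset[OF assms(1,3)] by simp
qed (simp add: coef_support_def)

lemma Proj_iff_coef_support:
  assumes "j \<in> V" "S \<subseteq> V - {j}" "U \<subseteq> S"
  shows "Proj M X V {j} (S - U) U \<longleftrightarrow> coef_support j S \<subseteq> U"
proof -
  have sub: "S \<subseteq> V" "U \<subseteq> V" "S - U \<subseteq> V"
    using assms by auto
  have XL: "X j \<in> L2 M"
    using X_L2 assms(1) .
  let ?r = "coord_proj_perp M X U (X j)"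
  have r: "?r = (\<lambda>\<omega>. X j \<omega> - comb (coef U (X j)) \<omega>)"
    by (simp add: coord_proj_perp_def coord_proj_eq_comb sub XL)
  have perp_L2: "coord_proj_perp M X U f \<in> L2 M" if "f \<in> L2 M" for f
    using that sub by (simp add: coord_proj_perp_def L2_diff coord_proj_L2)
  have "Proj M X V {j} (S - U) U \<longleftrightarrow>
      (\<forall>Y\<in>L2 M. L2_inner M ?r (coord_proj M X (S - U) Y) = 0)"
  proof -
    \<comment> \<open>The outer projection vanishes iff its argument is orthogonal to
      \<open>X j\<close>; self-adjointness then moves the complement of the projection for
      \<open>U\<close> onto \<open>X j\<close>, giving the residual \<open>?r\<close>.\<close>
    have "(AE \<omega> in M. coord_proj M X {j} (coord_proj_perp M X U (coord_proj M X (S - U) Y)) \<omega> = 0)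
        \<longleftrightarrow> L2_inner M ?r (coord_proj M X (S - U) Y) = 0" if "Y \<in> L2 M" for Y
      using that sub assms(1) XL
      by (simp add: coord_proj_single_AE_0_iff perp_L2 coord_proj_L2 coord_proj_perp_self_adjoint
          L2_inner_commute[of M ?r])
    then show ?thesis
      using assms sub by (auto simp: Proj_def L2_op_eq_def)
  qed
  also have "\<dots> \<longleftrightarrow> (\<forall>k\<in>S - U. L2_inner M ?r (X k) = 0)"
  proof
    assume *: "\<forall>Y\<in>L2 M. L2_inner M ?r (coord_proj M X (S - U) Y) = 0"
    show "\<forall>k\<in>S - U. L2_inner M ?r (X k) = 0"
    proof
      fix k assume k: "k \<in> S - U"
      then show "L2_inner M ?r (X k) = 0"
        \<comment> \<open>Test with Y = \<open>X k\<close>, which the projection for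
          \<open>S - U\<close> fixes.\<close>
        using *[rule_format, of "X k"] X_L2[of k] sub coord_proj_fixes[OF sub(3) k] by auto
    qed
  next
    assume "\<forall>k\<in>S - U. L2_inner M ?r (X k) = 0"
    then show "\<forall>Y\<in>L2 M. L2_inner M ?r (coord_proj M X (S - U) Y) = 0"
      using L2_inner_comb_right_eq_0[OF perp_L2[OF XL], of "S - U"] coef_outside[OF sub(3)]
      by (simp add: coord_proj_eq_comb[OF sub(3)])
  qed
  \<comment> \<open>\<open>?r\<close> is orthogonal to the variables in \<open>U\<close> by
    construction; orthogonality to those in \<open>S - U\<close> completes the system for
    \<open>S\<close>.\<close>
  also have "\<dots> \<longleftrightarrow> normal_eqs S (X j) (coef U (X j))"
    using normal_eqs_coef[OF sub(2) XL] assms(3) by (auto simp: normal_eqs_def r)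
  also have "\<dots> \<longleftrightarrow> coef_support j S \<subseteq> U"
  proof
    assume "normal_eqs S (X j) (coef U (X j))"
    then have "coef_support j S = coef_support j U"
      using coef_eqI sub XL by (simp add: coef_support_def)
    then show "coef_support j S \<subseteq> U"
      using coef_support_subset assms(1) sub by simp
  next
    assume "coef_support j S \<subseteq> U"
    then show "normal_eqs S (X j) (coef U (X j))"
      using coef_subset_eqI[OF assms(1) sub(1) assms(3)] normal_eqs_coef[OF sub(1) XL] by simp
  qed
  finally show ?thesis .
qed

text \<open>The intersected family consists of all sets between the support and \<open>S\<close>.
  The support lies in \<open>S\<close>, so it is itself a member, the least one.\<close>

lemma min_indep_Proj:
  assumes "j \<in> V" "S \<subseteq> V - {j}"
  shows "min_indep (Proj M X V) j S = coef_support j S"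
proof -
  have "{U. U \<subseteq> S \<and> Proj M X V {j} (S - U) U} = {U. U \<subseteq> S \<and> coef_support j S \<subseteq> U}"
    using Proj_iff_coef_support[OF assms] by blast
  moreover have "coef_support j S \<subseteq> S"
    using coef_support_subset assms by blast
  ultimately show ?thesis
    unfolding min_indep_def by auto
qed

lemma regression_lattice_eq_indep_lattice:
  assumes "j \<in> V" "S \<subseteq> V - {j}"
  shows "regression_lattice M X V j S = indep_lattice V j S (Proj M X V)"
proof -
  have S: "S \<subseteq> V"
    using assms(2) by blast
  have "coef U (X j) = coef S (X j) \<longleftrightarrow>
      min_indep (Proj M X V) j U = min_indep (Proj M X V) j S" if "U \<subseteq> V - {j}" for U
    using coef_eq_iff_coef_support_eq[OF assms(1) S, of U] that
    by (auto simp: min_indep_Proj[OF assms(1)] assms(2))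
  then show ?thesis
    unfolding regression_lattice_eq[OF assms(1) S] indep_lattice_def by blast
qed

end

theorem theorem7p1:
  fixes M :: "'a measure" and V :: "'v set" and X :: "'v \<Rightarrow> 'a \<Rightarrow> real"
  assumes "prob_space M"
    and "finite V"
    and "\<And>i. i \<in> V \<Longrightarrow> X i \<in> L2 M"
    and "pos_definite_on V (cov M X)"
  shows "\<forall>j\<in>V. \<forall>S. S \<subseteq> V - {j} \<longrightarrow>
           regression_lattice M X V j S = indep_lattice V j S (Proj M X V)"
proof -
  interpret nondegenerate_family M V X
    using assms by (rule nondegenerate_family.intro)
  show ?thesis
    using regression_lattice_eq_indep_lattice by blast
qed

end
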